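(* Let $p$ be a prime, $f\ge1$ and $q=p^f$, and regard $\mathbb{F}_q^\times=\mathbb{F}_q\setminus\{0\}$ as a subset of the additive group of $\mathbb{F}_q$. (1) If $p$ is odd, then $\mathbb{F}_q^\times$ is a GAP. More precisely: if $f=1$, it is an arithmetic progression; if $f>1$, it is not a proper GAP of any rank, but it has an improper GAP representation of rank at most $2f$. (2) If $p=2$, then $\mathbb{F}_q^\times$ is a GAP if and only if $q=2$.
   Context: For $r\ge1$, a rank-$r$ generalized arithmetic progression (GAP) in an abelian group is a set $P=a+[0,L_1-1]d_1+\cdots+[0,L_r-1]d_r=\{a+n_1d_1+\cdots+n_rd_r : n_i\in\mathbb{Z},\ 0\le n_i\le L_i-1\}$, where $L_i\ge 2$ are integers and each $d_i\neq 0$. The representation is proper when the parameter map $(n_1,\dots,n_r)\mapsto a+\sum_i n_id_i$ is injective on the box $\prod_i\{0,\dots,L_i-1\}$, equivalently $|P|=L_1\cdots L_r$; otherwise it is improper. A singleton is regarded as a rank-zero GAP. A set is a GAP if it is a GAP of some rank $r\ge 0$, and a proper GAP if it has some proper representation. An arithmetic progression is a set of the form $\{a+nd: 0\le n\le L-1\}$. *)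

theory Defs
  imports
    "HOL-Computational_Algebra.Primes"
    "HOL-Library.FuncSet"
    "HOL-Library.Cardinality"
begin

text \<open>The multiple \<open>n d\<close> in an abelian group; in a ring this is \<open>of_nat n * d\<close>
  (simp rule \<open>sum_constant\<close>).\<close>

definition nmult :: "nat \<Rightarrow> 'a::ab_group_add \<Rightarrow> 'a" where
  "nmult n d = (\<Sum>_<n. d)"

text \<open>The parameters \<open>L\<close>, \<open>d\<close>, \<open>n\<close> of rank \<open>r\<close> are functions on \<^typ>\<open>nat\<close> of which only
  the values at \<open>0, \<dots>, r - 1\<close> matter. The box uses the extensional product, so that
  a parameter vector is determined by these values and injectivity on the box is meaningful.
  For \<open>r = 0\<close> the box has one element and the representations are those of singletons,
  all of them proper.\<close>

definition gap_box :: "nat \<Rightarrow> (nat \<Rightarrow> nat) \<Rightarrow> (nat \<Rightarrow> nat) set" where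
  "gap_box r L = (\<Pi>\<^sub>E i\<in>{..<r}. {..<L i})"

definition gap_map :: "nat \<Rightarrow> 'a::ab_group_add \<Rightarrow> (nat \<Rightarrow> 'a) \<Rightarrow> (nat \<Rightarrow> nat) \<Rightarrow> 'a" where
  "gap_map r a d n = a + (\<Sum>i<r. nmult (n i) (d i))"

definition gap_rep ::
  "nat \<Rightarrow> 'a::ab_group_add \<Rightarrow> (nat \<Rightarrow> nat) \<Rightarrow> (nat \<Rightarrow> 'a) \<Rightarrow> 'a set \<Rightarrow> bool" where
  "gap_rep r a L d P \<longleftrightarrow>
     (\<forall>i<r. 2 \<le> L i \<and> d i \<noteq> 0) \<and> P = gap_map r a d ` gap_box r L"

definition proper_gap_rep ::
  "nat \<Rightarrow> 'a::ab_group_add \<Rightarrow> (nat \<Rightarrow> nat) \<Rightarrow> (nat \<Rightarrow> 'a) \<Rightarrow> 'a set \<Rightarrow> bool" where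
  "proper_gap_rep r a L d P \<longleftrightarrow>
     gap_rep r a L d P \<and> inj_on (gap_map r a d) (gap_box r L)"

definition improper_gap_rep ::
  "nat \<Rightarrow> 'a::ab_group_add \<Rightarrow> (nat \<Rightarrow> nat) \<Rightarrow> (nat \<Rightarrow> 'a) \<Rightarrow> 'a set \<Rightarrow> bool" where
  "improper_gap_rep r a L d P \<longleftrightarrow>
     gap_rep r a L d P \<and> \<not> inj_on (gap_map r a d) (gap_box r L)"

definition is_gap :: "'a::ab_group_add set \<Rightarrow> bool" where
  "is_gap P \<longleftrightarrow> (\<exists>r a L d. gap_rep r a L d P)"

definition is_proper_gap :: "'a::ab_group_add set \<Rightarrow> bool" where
  "is_proper_gap P \<longleftrightarrow> (\<exists>r a L d. proper_gap_rep r a L d P)"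

definition is_arith_prog :: "'a::ab_group_add set \<Rightarrow> bool" where
  "is_arith_prog A \<longleftrightarrow> (\<exists>a d L. 1 \<le> L \<and> A = {a + nmult n d | n. n < L})"

end

theory Submission
  imports Defs
begin

text \<open>
  Choose a basis \<open>e\<^sub>0, \<dots>, e\<^sub>g\<close> of the field over its prime field, where \<open>f = g + 1 \<ge> 2\<close> and \<open>p\<close> is
  odd, and put \<open>b\<^sub>0 = e\<^sub>0 - e\<^sub>g\<close> and \<open>b\<^sub>j = e\<^sub>j + e\<^sub>j\<^sub>-\<^sub>1\<close> for \<open>0 < j \<le> g\<close>.  Then the
  nonzero elements are \<open>e\<^sub>g + \<Sum>\<^sub>i [0, p - 2] e\<^sub>i + \<Sum>\<^sub>j {0, 1} b\<^sub>j\<close>.  Indeed, \<open>\<Sum>\<^sub>i n\<^sub>i e\<^sub>i\<close> is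
  missed iff every choice of \<open>\<epsilon> \<in> {0, 1}\<^sup>f\<close> violates one of the constraints
  \<open>\<epsilon>\<^sub>i + \<epsilon>\<^sub>i\<^sub>+\<^sub>1 \<noteq> n\<^sub>i + 1\<close> (\<open>i < g\<close>) and \<open>\<epsilon>\<^sub>g - \<epsilon>\<^sub>0 \<noteq> n\<^sub>g\<close> modulo \<open>p\<close>.  For \<open>n = 0\<close> these say
  \<open>\<epsilon>\<^sub>0 = \<dots> = \<epsilon>\<^sub>g \<noteq> \<epsilon>\<^sub>0\<close>; as soon as some \<open>n\<^sub>i\<close> is nonzero, constraint \<open>i\<close> excludes at
  most one pair of values, which is not enough to close the contradictory cycle.

  If a set with a proper representation of first length \<open>L\<close> and first difference \<open>d\<close> is cut by a
  coset of the line through \<open>d\<close>, the section has cardinality divisible by \<open>L\<close>.  For the nonzero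
  elements the sections have \<open>p - 1\<close> and (if \<open>f > 1\<close>) also \<open>p\<close> elements, so \<open>L\<close> would be \<open>1\<close>.
  In characteristic \<open>2\<close> every set with a representation of positive rank is invariant under
  translation by \<open>d\<close>, so it contains \<open>d + d = 0\<close> if it contains \<open>d\<close>.
\<close>

lemma nmult_eq: "nmult n (d :: 'a::ring_1) = of_nat n * d"
  by (simp add: nmult_def)

section \<open>Bases over the prime field\<close>

text \<open>Translation by 1 permutes the ring, so the sum of all elements does not change when 1 is
  added to each of them.\<close>

lemma of_nat_card_eq_0: "of_nat CARD('a::{ring_1,finite}) = (0 :: 'a)"
proof -
  have "(\<Sum>x\<in>UNIV. x :: 'a) = (\<Sum>x\<in>UNIV. x + 1)"
    by (rule sum.reindex_bij_witness[of _ "\<lambda>x. x + 1" "\<lambda>x. x - 1"]) auto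
  then show ?thesis by (simp add: sum.distrib)
qed

lemma of_int_mod:
  assumes "of_nat p = (0 :: 'a::ring_1)"
  shows "of_int (z mod int p) = (of_int z :: 'a)"
proof -
  have "of_int z = (of_int (int p * (z div int p) + z mod int p) :: 'a)" by simp
  also have "\<dots> = of_nat p * of_int (z div int p) + of_int (z mod int p)"
    by (simp only: of_int_add of_int_mult of_int_of_nat_eq)
  finally show ?thesis using assms by simp
qed

lemma of_nat_nat_mod:
  assumes "0 < p" and "of_nat p = (0 :: 'a::ring_1)"
  shows "of_nat (nat (z mod int p)) = (of_int z :: 'a)"
  using of_int_mod[OF assms(2), of z] assms(1) by (simp add: of_nat_nat)

lemma of_int_eq_0_if_dvd:
  assumes "of_nat p = (0 :: 'a::ring_1)" and "int p dvd z"
  shows "of_int z = (0 :: 'a)"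
  using of_int_mod[OF assms(1), of z] assms(2) by (simp add: dvd_eq_mod_eq_0)

lemma not_prime_dvd_inverse:
  assumes "prime p" and "of_nat p = (0 :: 'a::ring_1)" and "\<not> int p dvd z"
  obtains w where "of_int w * of_int z = (1 :: 'a)"
proof -
  have "coprime (int p) z" using assms by (intro prime_imp_coprime) auto
  then obtain u v where "u * z + v * int p = 1"
    using bezout_int[of z "int p"] by (auto simp: coprime_iff_gcd_eq_1 gcd.commute)
  then have "of_int (u * z + v * int p) = (1 :: 'a)" by simp
  then have "of_int u * of_int z = (1 :: 'a)" using assms(2) by simp
  then show ?thesis by (rule that)
qed

lemma inj_on_of_nat_lessThan_char:
  assumes "prime p" and "of_nat p = (0 :: 'a::field)"
  shows "inj_on (of_nat :: nat \<Rightarrow> 'a) {..<p}"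
proof (rule inj_onI)
  fix i j assume ij: "i \<in> {..<p}" "j \<in> {..<p}" "of_nat i = (of_nat j :: 'a)"
  then have eq: "of_int (int i - int j) = (0 :: 'a)" by simp
  have "int p dvd int i - int j"
  proof (rule ccontr)
    assume "\<not> ?thesis"
    then obtain w where "of_int w * of_int (int i - int j) = (1 :: 'a)"
      using not_prime_dvd_inverse assms(1,2) by blast
    with eq show False by simp
  qed
  moreover have "\<bar>int i - int j\<bar> < int p" using ij by auto
  ultimately show "i = j" using zdvd_not_zless[of "\<bar>int i - int j\<bar>" "int p"] by fastforce
qed

lemma int_combination_in_box_image:
  fixes e :: "nat \<Rightarrow> 'a::ring_1"
  assumes "0 < p" and "of_nat p = (0 :: 'a)"
  shows "(\<Sum>i<k. of_int (z i) * e i) \<in>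
    (\<lambda>n. \<Sum>i<k. of_nat (n i) * e i) ` (\<Pi>\<^sub>E i\<in>{..<k}. {..<p})"
proof (rule image_eqI)
  let ?n = "restrict (\<lambda>i. nat (z i mod int p)) {..<k}"
  show "(\<Sum>i<k. of_int (z i) * e i) = (\<Sum>i<k. of_nat (?n i) * e i)"
    by (rule sum.cong) (simp_all add: of_nat_nat_mod assms del: of_nat_nat)
  show "?n \<in> (\<Pi>\<^sub>E i\<in>{..<k}. {..<p})"
    using assms(1) by (auto simp: nat_less_iff)
qed

text \<open>Integer coefficients modulo \<open>p\<close> stand in for scalars of the prime field.
  The family grows greedily: \<open>k\<close> elements have at most \<open>p ^ k\<close>
  combinations, so for \<open>k < f\<close> some \<open>x\<close> is not among them. A relation
  whose coefficient at \<open>x\<close> is invertible could be solved for \<open>x\<close>.\<close>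

lemma ex_independent:
  assumes "prime p" and "CARD('a::{field,finite}) = p ^ f" and "of_nat p = (0 :: 'a)" and "k \<le> f"
  shows "\<exists>e :: nat \<Rightarrow> 'a. \<forall>z :: nat \<Rightarrow> int.
    (\<Sum>i<k. of_int (z i) * e i) = 0 \<longrightarrow> (\<forall>i<k. int p dvd z i)"
  using assms(4)
proof (induction k)
  case 0
  show ?case by simp
next
  case (Suc k)
  have p1: "1 < p" using assms(1) prime_gt_1_nat by blast
  from Suc obtain e :: "nat \<Rightarrow> 'a" where
    e: "(\<Sum>i<k. of_int (z i) * e i) = 0 \<Longrightarrow> i < k \<Longrightarrow> int p dvd z i" for z i
    by (metis Suc_leD)
  \<comment> \<open>\<open>H\<close> is the span of the elements chosen so far, with coefficients
    reduced to representatives below \<open>p\<close>.\<close>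
  define H where "H = (\<lambda>n. \<Sum>i<k. of_nat (n i) * e i) ` (\<Pi>\<^sub>E i\<in>{..<k}. {..<p})"
  have "card H \<le> card (\<Pi>\<^sub>E i\<in>{..<k}. {..<p})"
    unfolding H_def by (intro card_image_le finite_PiE) auto
  also have "\<dots> = p ^ k" by (simp add: card_PiE)
  also have "\<dots> < p ^ f" using Suc.prems p1 by simp
  finally have "H \<noteq> UNIV" using assms(2) by auto
  then obtain x where x: "x \<notin> H" by blast
  have H: "(\<Sum>i<k. of_int (z i) * e i) \<in> H" for z
    unfolding H_def using int_combination_in_box_image[OF _ assms(3)] p1 by simp
  have "\<forall>i<Suc k. int p dvd z i"
    if "(\<Sum>i<Suc k. of_int (z i) * (e(k := x)) i) = 0" for z
  proof -
    from that have s: "(\<Sum>i<k. of_int (z i) * e i) + of_int (z k) * x = 0" by simp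
    have k: "int p dvd z k"
    proof (rule ccontr)
      assume "\<not> int p dvd z k"
      then obtain w where w: "of_int w * of_int (z k) = (1 :: 'a)"
        using not_prime_dvd_inverse assms(1,3) by blast
      have "x = of_int w * (of_int (z k) * x)" using w by (simp flip: mult.assoc)
      also have "\<dots> = - of_int w * (\<Sum>i<k. of_int (z i) * e i)"
        using s by (simp add: eq_neg_iff_add_eq_0 add.commute flip: distrib_left)
      also have "\<dots> = (\<Sum>i<k. of_int (- w * z i) * e i)"
        by (simp add: sum_distrib_left mult.assoc sum_negf)
      finally show False using x H[of "\<lambda>i. - w * z i"] by simp
    qed
    then have "(\<Sum>i<k. of_int (z i) * e i) = 0"
      using s of_int_eq_0_if_dvd[OF assms(3) k] by simp
    then show ?thesis using e k less_Suc_eq by auto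
  qed
  then show ?case by blast
qed

text \<open>Spanning follows by counting: independence makes the combination map injective on a box
  of \<open>p ^ f\<close> coefficient vectors, which is the size of the field.\<close>

lemma ex_basis:
  assumes "prime p" and "CARD('a::{field,finite}) = p ^ f" and "of_nat p = (0 :: 'a)"
  obtains e :: "nat \<Rightarrow> 'a::{field,finite}"
  where "\<And>z i. (\<Sum>i<f. of_int (z i) * e i) = 0 \<Longrightarrow> i < f \<Longrightarrow> int p dvd z i"
    and "\<And>x. \<exists>z. x = (\<Sum>i<f. of_int (z i) * e i)"
proof -
  obtain e :: "nat \<Rightarrow> 'a" where
    e: "(\<Sum>i<f. of_int (z i) * e i) = 0 \<Longrightarrow> i < f \<Longrightarrow> int p dvd z i" for z i
    using ex_independent[OF assms order_refl] by auto
  let ?B = "\<Pi>\<^sub>E i\<in>{..<f}. {..<p}" and ?h = "\<lambda>n. \<Sum>i<f. of_nat (n i) * e i"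
  have inj: "inj_on ?h ?B"
  proof (rule inj_onI)
    fix m n assume mn: "m \<in> ?B" "n \<in> ?B" "?h m = ?h n"
    then have "(\<Sum>i<f. of_int (int (m i) - int (n i)) * e i) = 0"
      by (simp add: left_diff_distrib sum_subtractf)
    then have d: "int p dvd int (m i) - int (n i)" if "i < f" for i
      using that by (rule e)
    show "m = n"
    proof (rule PiE_ext[OF mn(1,2)])
      fix i assume i: "i \<in> {..<f}"
      then have "m i < p" "n i < p" using mn by auto
      then have "\<bar>int (m i) - int (n i)\<bar> < int p" by auto
      with d[of i] i show "m i = n i"
        using zdvd_not_zless[of "\<bar>int (m i) - int (n i)\<bar>" "int p"] by fastforce
    qed
  qed
  have "card (?h ` ?B) = CARD('a)"
    using card_image[OF inj] by (simp add: card_PiE assms(2))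
  then have surj: "?h ` ?B = UNIV" by (intro card_eq_UNIV_imp_eq_UNIV) auto
  have "\<exists>z. x = (\<Sum>i<f. of_int (z i) * e i)" for x
  proof -
    from surj obtain n where "x = ?h n" by blast
    then have "x = (\<Sum>i<f. of_int (int (n i)) * e i)" by simp
    then show ?thesis by (rule exI[of _ "\<lambda>i. int (n i)"])
  qed
  with e show ?thesis by (rule that)
qed

section \<open>The improper representation\<close>

lemma int_dvd_small:
  assumes "3 \<le> p" and "\<bar>x\<bar> \<le> 2" and "int p dvd x"
  shows "x = 0"
  using assms zdvd_imp_le[of "int p" "\<bar>x\<bar>"] by force

text \<open>The parity of the number of elements of \<open>D\<close> below \<open>i\<close> flips
  exactly at the indices in \<open>D\<close>; negating it throughout, if necessary, adjusts the
  value at \<open>k\<close>.\<close>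

lemma ex_alternating:
  obtains s :: "nat \<Rightarrow> bool" where "s k = b" and "\<And>i. s (Suc i) = s i \<longleftrightarrow> i \<notin> D"
proof -
  define c where "c i = even (card (D \<inter> {..<i}))" for i
  have c: "c (Suc i) = c i \<longleftrightarrow> i \<notin> D" for i
    by (simp add: c_def lessThan_Suc Int_insert_right)
  show ?thesis
  proof (rule that[of "\<lambda>i. c i = (c k = b)"])
    show "(c k = (c k = b)) = b" by blast
    show "(c (Suc i) = (c k = b)) = (c i = (c k = b)) \<longleftrightarrow> i \<notin> D" for i
      using c[of i] by blast
  qed
qed

lemma ex_cyclic_choice:
  fixes n :: "nat \<Rightarrow> int"
  assumes p: "3 \<le> p" and n: "\<exists>i\<le>g. \<not> int p dvd n i"
  obtains \<epsilon> :: "nat \<Rightarrow> nat" where "\<And>i. \<epsilon> i < 2"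
    and "\<And>i. i < g \<Longrightarrow> \<not> int p dvd n i + 1 - int (\<epsilon> i) - int (\<epsilon> (Suc i))"
    and "\<not> int p dvd n g - int (\<epsilon> g) + int (\<epsilon> 0)"
proof -
  let ?D = "{i. \<not> int p dvd n i}"
  let ?v = "of_bool :: bool \<Rightarrow> int"
  \<comment> \<open>Equal values sum to 0 or 2, hence not to 1 modulo \<open>p\<close>, which suits
    \<open>n i\<close> zero modulo \<open>p\<close>. Unequal values sum to 1 and leave
    \<open>n i\<close> itself, which suits the other case.\<close>
  have step: "\<not> int p dvd n i + 1 - ?v x - ?v y" if "x = y \<longleftrightarrow> int p dvd n i" for i x y
  proof
    assume a: "int p dvd n i + 1 - ?v x - ?v y"
    show False
    proof (cases "int p dvd n i")
      case True
      have "int p dvd (n i + 1 - ?v x - ?v y) - n i" using a True by (rule dvd_diff)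
      also have "(n i + 1 - ?v x - ?v y) - n i = 1 - ?v x - ?v y" by simp
      finally have "int p dvd 1 - ?v x - ?v y" .
      moreover have "\<bar>1 - ?v x - ?v y\<bar> \<le> 2" by (cases x; cases y) auto
      ultimately have "1 - ?v x - ?v y = 0" using int_dvd_small[OF p] by blast
      with True that show False by (cases x; cases y) auto
    next
      case False
      with that a show False by (cases x; cases y) auto
    qed
  qed
  \<comment> \<open>Otherwise \<open>p\<close> would divide the difference 2 of the two
    values.\<close>
  have one_sign: "\<exists>b. \<not> int p dvd m + (if b then 1 else -1)" for m
  proof (rule ccontr)
    assume "\<not> ?thesis"
    then have *: "int p dvd m + (if b then 1 else -1)" for b by blast
    have "int p dvd (m + 1) - (m + - 1)" using *[of True] *[of False] by (intro dvd_diff) simp_all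
    with int_dvd_small[OF p, of 2] show False by simp
  qed
  have "\<exists>s :: nat \<Rightarrow> bool. (\<forall>i<g. \<not> int p dvd n i + 1 - ?v (s i) - ?v (s (Suc i))) \<and>
    \<not> int p dvd n g - ?v (s g) + ?v (s 0)"
  proof -
    obtain s where s: "s 0 = True" "s (Suc i) = s i \<longleftrightarrow> i \<notin> ?D" for i
      by (rule ex_alternating[of 0 True ?D]) (rule that)
    show ?thesis
    proof (cases "int p dvd n g")
      case False
      \<comment> \<open>If the ends agree, the closing expression is \<open>n g\<close>. If they
        differ, it is \<open>n g + 1\<close> or \<open>n g - 1\<close> according to the value at 0,
        so fixing \<open>s 0 = b\<close> keeps it away from multiples of \<open>p\<close>.\<close>
      from one_sign[of "n g"] obtain b where b: "\<not> int p dvd n g + (if b then 1 else -1)" by blast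
      obtain s where s: "s 0 = b" "s (Suc i) = s i \<longleftrightarrow> i \<notin> ?D" for i
        by (rule ex_alternating[of 0 b ?D]) (rule that)
      have "\<not> int p dvd n g - ?v (s g) + ?v (s 0)"
        using b s(1) False by (cases b; cases "s g") auto
      moreover have "\<not> int p dvd n i + 1 - ?v (s i) - ?v (s (Suc i))" for i
        by (rule step) (use s(2)[of i] in auto)
      ultimately show ?thesis by blast
    next
      case True
      have close: "\<not> int p dvd n g - ?v x + ?v y" if "x \<noteq> y" for x y
      proof
        assume "int p dvd n g - ?v x + ?v y"
        then have "int p dvd (n g - ?v x + ?v y) - n g" using True by (rule dvd_diff)
        also have "(n g - ?v x + ?v y) - n g = ?v y - ?v x" by simp
        finally have "int p dvd ?v y - ?v x" .
        moreover have "\<bar>?v y - ?v x\<bar> \<le> 2" by (cases x; cases y) auto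
        ultimately have "?v y - ?v x = 0" using int_dvd_small[OF p] by blast
        with that show False by (cases x; cases y) auto
      qed
      show ?thesis
      proof (cases "s g = s 0")
        case False
        moreover have "\<not> int p dvd n i + 1 - ?v (s i) - ?v (s (Suc i))" for i
          by (rule step) (use s(2)[of i] in auto)
        ultimately show ?thesis using close by blast
      next
        case eq: True
        \<comment> \<open>The ends must differ but \<open>s\<close> closes up. Dropping the flip at
          one index \<open>k\<close> of \<open>?D\<close> changes the parity of the number of flips.
          At \<open>k\<close> two equal values are then allowed, provided that they are
          \<open>\<not> b\<close>, which makes the expression there \<open>n k + 1\<close> or
          \<open>n k - 1\<close>.\<close>
        from n True obtain k where k: "k < g" "\<not> int p dvd n k"
          by (metis le_neq_implies_less)
        from one_sign[of "n k"] obtain b where b: "\<not> int p dvd n k + (if b then 1 else -1)" by blast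
        obtain t where t: "t k = (\<not> b)" "t (Suc i) = t i \<longleftrightarrow> i \<notin> ?D - {k}" for i
          by (rule ex_alternating[of k "\<not> b" "?D - {k}"]) (rule that)
        \<comment> \<open>Up to \<open>k\<close> the patterns \<open>t\<close> and \<open>s\<close>
          compare as they do at 0; beyond \<open>k\<close> the comparison is reversed.\<close>
        have rel: "(t i = s i) = ((t 0 = s 0) = (i \<le> k))" for i
        proof (induction i)
          case (Suc i)
          then show ?case using t(2)[of i] s(2)[of i] k(2) by (cases "i = k") auto
        qed simp
        have "t g \<noteq> t 0" using rel[of g] eq k(1) by auto
        have "\<not> int p dvd n i + 1 - ?v (t i) - ?v (t (Suc i))" for i
        proof (cases "i = k")
          case True
          then show ?thesis using b t(1) t(2)[of k] by (cases b) auto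
        next
          case False
          then show ?thesis by (intro step) (use t(2)[of i] in auto)
        qed
        moreover have "\<not> int p dvd n g - ?v (t g) + ?v (t 0)" using \<open>t g \<noteq> t 0\<close> by (rule close)
        ultimately show ?thesis by blast
      qed
    qed
  qed
  then obtain s where "\<forall>i<g. \<not> int p dvd n i + 1 - ?v (s i) - ?v (s (Suc i))"
    "\<not> int p dvd n g - ?v (s g) + ?v (s 0)" by blast
  then show ?thesis by (intro that[of "\<lambda>i. of_bool (s i)"]) (auto simp: of_bool_def)
qed

text \<open>Each \<open>m i + 1\<close> lies strictly between 0 and \<open>p\<close>. Unequal
  neighbours would make \<open>p\<close> divide \<open>m i + 1\<close>, so \<epsilon> is constant
  and the closing expression is \<open>m g + 1\<close>.\<close>

lemma no_cyclic_choice: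
  fixes m \<epsilon> :: "nat \<Rightarrow> nat"
  assumes p: "3 \<le> p" and m: "\<And>i. i \<le> g \<Longrightarrow> m i < p - 1" and \<epsilon>: "\<And>i. i \<le> g \<Longrightarrow> \<epsilon> i < 2"
    and dvd: "\<And>i. i < g \<Longrightarrow> int p dvd int (m i) + int (\<epsilon> i) + int (\<epsilon> (Suc i))"
  shows "\<not> int p dvd int (m g) + int (\<epsilon> g) - int (\<epsilon> 0) + 1"
proof -
  have "\<epsilon> i = \<epsilon> 0" if "i \<le> g" for i
    using that
  proof (induction i)
    case (Suc i)
    have "\<epsilon> i = \<epsilon> (Suc i)"
    proof (rule ccontr)
      assume "\<epsilon> i \<noteq> \<epsilon> (Suc i)"
      with \<epsilon>[of i] \<epsilon>[of "Suc i"] Suc.prems have "\<epsilon> i + \<epsilon> (Suc i) = 1" by auto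
      then have "int (m i) + int (\<epsilon> i) + int (\<epsilon> (Suc i)) = int (m i + 1)" by linarith
      with dvd[of i] Suc.prems have "p dvd m i + 1" by (simp only: of_nat_dvd_iff Suc_le_eq)
      with m[of i] Suc.prems p show False using dvd_imp_le[of p "m i + 1"] by auto
    qed
    with Suc show ?case by simp
  qed simp
  then have "\<epsilon> g = \<epsilon> 0" by blast
  then have "int (m g) + int (\<epsilon> g) - int (\<epsilon> 0) + 1 = int (m g + 1)" by simp
  moreover have "\<not> p dvd m g + 1"
    using m[of g] p dvd_imp_le[of p "m g + 1"] by auto
  ultimately show ?thesis by (simp only: of_nat_dvd_iff not_False_eq_True)
qed

text \<open>For \<open>i < g\<close> the element \<open>e i\<close> occurs in the differences number
  \<open>i\<close> and \<open>i + 1\<close>; \<open>e g\<close> occurs in number \<open>g\<close>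
  and, negatively, in number 0.\<close>

lemma sum_cyclic_differences:
  fixes e :: "nat \<Rightarrow> 'a::comm_ring_1"
  shows "(\<Sum>j<Suc g. of_int (x j) * (if j = 0 then e 0 - e g else e j + e (j - 1))) =
    (\<Sum>i<g. of_int (x i + x (Suc i)) * e i) + of_int (x g - x 0) * e g"
proof -
  have "(\<Sum>j<Suc g. of_int (x j) * (if j = 0 then e 0 - e g else e j + e (j - 1))) =
    of_int (x 0) * (e 0 - e g) + (\<Sum>j<g. of_int (x (Suc j)) * (e (Suc j) + e j))"
    by (subst sum.lessThan_Suc_shift) simp
  also have "\<dots> = (of_int (x 0) * e 0 + (\<Sum>j<g. of_int (x (Suc j)) * e (Suc j)))
      - of_int (x 0) * e g + (\<Sum>j<g. of_int (x (Suc j)) * e j)"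
    by (simp add: algebra_simps sum.distrib)
  also have "of_int (x 0) * e 0 + (\<Sum>j<g. of_int (x (Suc j)) * e (Suc j)) =
      (\<Sum>j<Suc g. of_int (x j) * e j)"
    by (subst sum.lessThan_Suc_shift) simp
  finally show ?thesis by (simp add: algebra_simps sum.distrib)
qed

lemma ex_gap_rep_nonzero:
  assumes "prime p" and "odd p" and "2 \<le> f"
    and card: "CARD('a::{field,finite}) = p ^ f" and char: "of_nat p = (0 :: 'a)"
  shows "\<exists>(a :: 'a) L d. gap_rep (2 * f) a L d (UNIV - {0})"
proof -
  have p3: "3 \<le> p"
    using prime_ge_2_nat[OF assms(1)] assms(2) by (cases "p = 2") auto
  obtain g where f: "f = Suc g" and g: "0 < g" using assms(3) by (cases f) auto
  obtain e :: "nat \<Rightarrow> 'a" where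
    indep: "\<And>z i. (\<Sum>i<f. of_int (z i) * e i) = 0 \<Longrightarrow> i < f \<Longrightarrow> int p dvd z i" and
    span: "\<And>x. \<exists>z. x = (\<Sum>i<f. of_int (z i) * e i)"
    using ex_basis[OF assms(1) card char] by blast
  define b where "b j = (if j = 0 then e 0 - e g else e j + e (j - 1))" for j
  define d where "d i = (if i < f then e i else b (i - f))" for i
  define L where "L i = (if i < f then p - 1 else 2)" for i :: nat
  \<comment> \<open>The coordinate at \<open>e i\<close> of the point with parameters
    \<open>n\<close>; parameters from index \<open>f\<close> on play the role of \<epsilon>, and the
    final \<open>+ 1\<close> comes from the base point \<open>e g\<close>.\<close>
  define coord where
    "coord n i = int (n i) + (if i < g then int (n (f + i)) + int (n (f + Suc i))
       else int (n (f + g)) - int (n f) + 1)" for n :: "nat \<Rightarrow> nat" and i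
  have gap: "gap_map (2 * f) (e g) d n = (\<Sum>i<f. of_int (coord n i) * e i)" for n
  proof -
    have "(\<Sum>i<k + m. h i) = (\<Sum>i<k. h i) + (\<Sum>j<m. h (k + j))" for k m and h :: "nat \<Rightarrow> 'a"
      by (induction m) (simp_all add: add.assoc)
    then have "(\<Sum>i<2 * f. of_nat (n i) * d i) =
        (\<Sum>i<f. of_nat (n i) * d i) + (\<Sum>j<f. of_nat (n (f + j)) * d (f + j))"
      by (simp only: mult_2)
    also have "\<dots> = (\<Sum>i<f. of_nat (n i) * e i) + (\<Sum>j<Suc g. of_int (int (n (f + j))) * b j)"
      by (simp add: d_def f)
    also have "(\<Sum>j<Suc g. of_int (int (n (f + j))) * b j) =
        (\<Sum>i<g. of_int (int (n (f + i)) + int (n (f + Suc i))) * e i) +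
        of_int (int (n (f + g)) - int (n f)) * e g"
      using sum_cyclic_differences[of "\<lambda>j. int (n (f + j))" e g] by (simp only: b_def add_0_right)
    finally show ?thesis
      by (simp add: gap_map_def nmult_eq coord_def f distrib_right sum.distrib)
  qed
  have e0: "e i \<noteq> 0" if "i < f" for i
  proof
    assume "e i = 0"
    then have "(\<Sum>j<f. of_int (of_bool (j = i)) * e j) = 0"
      by (intro sum.neutral) auto
    from indep[OF this that] p3 show False by simp
  qed
  have b0: "b j \<noteq> 0" if "j < f" for j
  proof
    assume "b j = 0"
    \<comment> \<open>These are the coordinates of \<open>b j\<close>. The one at \<open>j\<close>
      is 1; for \<open>j = 0\<close> this needs \<open>g > 0\<close>, since otherwise
      \<open>e 0 - e g\<close> would vanish.\<close>
    define z :: "nat \<Rightarrow> int" where "z i =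
      (if j = 0 then of_bool (i = 0) - of_bool (i = g) else of_bool (i = j) + of_bool (i = j - 1))" for i
    have unit: "(\<Sum>i<f. of_bool (i = k) * e i) = e k" if "k < f" for k
      using that by (simp add: of_bool_def if_distrib[of "\<lambda>x. x * _"] cong: if_cong)
    have "(\<Sum>i<f. of_int (z i) * e i) = b j"
      using unit[of 0] unit[of g] unit[of j] unit[of "j - 1"] that
      by (simp add: z_def b_def f left_diff_distrib distrib_right sum_subtractf sum.distrib
          del: sum.lessThan_Suc)
    with indep[of z j] that \<open>b j = 0\<close> have "int p dvd z j" by simp
    moreover have "z j = 1" using g by (cases j) (auto simp: z_def)
    ultimately show False using p3 by simp
  qed
  have "gap_rep (2 * f) (e g) L d (UNIV - {0})"
    unfolding gap_rep_def
  proof (intro conjI allI impI)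
    fix i assume "i < 2 * f"
    then show "2 \<le> L i" "d i \<noteq> 0" using p3 e0 b0 by (auto simp: L_def d_def)
  next
    show "UNIV - {0} = gap_map (2 * f) (e g) d ` gap_box (2 * f) L"
    proof (intro equalityI subsetI)
      fix x :: 'a assume x: "x \<in> UNIV - {0}"
      obtain z where z: "x = (\<Sum>i<f. of_int (z i) * e i)" using span by blast
      have "\<exists>i\<le>g. \<not> int p dvd z i"
      proof (rule ccontr)
        assume "\<not> ?thesis"
        then have "x = 0" unfolding z f
          by (intro sum.neutral) (use of_int_eq_0_if_dvd[OF char] in auto)
        with x show False by simp
      qed
      then obtain \<epsilon> where \<epsilon>: "\<And>i. \<epsilon> i < 2"
        and step: "\<And>i. i < g \<Longrightarrow> \<not> int p dvd z i + 1 - int (\<epsilon> i) - int (\<epsilon> (Suc i))"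
        and last: "\<not> int p dvd z g - int (\<epsilon> g) + int (\<epsilon> 0)"
        using ex_cyclic_choice[OF p3] by metis
      \<comment> \<open>What remains for the multiples of \<open>e i\<close> once \<epsilon> is
        chosen. Its residue must be at most \<open>p - 2\<close>, that is, \<open>m i + 1\<close>
        must not be divisible by \<open>p\<close>: exactly the constraints on \<epsilon>.\<close>
      define m where "m i = (if i < g then z i - int (\<epsilon> i) - int (\<epsilon> (Suc i))
         else z g - int (\<epsilon> g) + int (\<epsilon> 0) - 1)" for i
      have m: "m i mod int p < int p - 1" if "i < f" for i
      proof -
        have "\<not> int p dvd m i + 1"
          using step[of i] last that by (auto simp: m_def algebra_simps)
        then have "m i mod int p \<noteq> int p - 1"
          using mod_add_left_eq[of "m i" "int p" 1] by (auto simp: dvd_eq_mod_eq_0)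
        moreover have "m i mod int p < int p" using p3 by simp
        ultimately show ?thesis by simp
      qed
      define n where "n = restrict (\<lambda>i. if i < f then nat (m i mod int p) else \<epsilon> (i - f)) {..<2 * f}"
      have "of_int (coord n i) = (of_int (z i) :: 'a)" if "i < f" for i
      proof -
        have n: "n i = nat (m i mod int p)" "n (f + g) = \<epsilon> g" "n f = \<epsilon> 0"
          "n (f + i) = \<epsilon> i" "i < g \<Longrightarrow> n (f + Suc i) = \<epsilon> (Suc i)"
          using that by (auto simp: n_def f)
        have "of_nat (n i) = (of_int (m i) :: 'a)"
          using of_nat_nat_mod[OF _ char, of "m i"] p3 by (simp add: n del: of_nat_nat)
        then show ?thesis using n(2-) that f by (cases "i < g") (auto simp: coord_def m_def less_Suc_eq)
      qed
      then have "x = gap_map (2 * f) (e g) d n" unfolding gap z by simp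
      moreover have "n \<in> gap_box (2 * f) L"
        using m \<epsilon> p3 by (auto simp: gap_box_def n_def L_def nat_less_iff)
      ultimately show "x \<in> gap_map (2 * f) (e g) d ` gap_box (2 * f) L" by blast
    next
      fix x assume "x \<in> gap_map (2 * f) (e g) d ` gap_box (2 * f) L"
      then obtain n where n: "n \<in> gap_box (2 * f) L" and x: "x = (\<Sum>i<f. of_int (coord n i) * e i)"
        unfolding gap by blast
      have nL: "n i < L i" if "i < 2 * f" for i
        using n that by (auto simp: gap_box_def)
      have "x \<noteq> 0"
      proof
        assume "x = 0"
        then have c: "int p dvd coord n i" if "i < f" for i by (intro indep[OF _ that]) (simp flip: x)
        have "\<not> int p dvd int (n g) + int (n (f + g)) - int (n (f + 0)) + 1"
        proof (rule no_cyclic_choice[OF p3])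
          show "n i < p - 1" if "i \<le> g" for i using nL[of i] that f by (simp add: L_def)
          show "n (f + i) < 2" if "i \<le> g" for i using nL[of "f + i"] that f by (simp add: L_def)
          show "int p dvd int (n i) + int (n (f + i)) + int (n (f + Suc i))" if "i < g" for i
            using c[of i] that f by (simp add: coord_def add.assoc)
        qed
        with c[of g] f show False by (simp add: coord_def algebra_simps)
      qed
      then show "x \<in> UNIV - {0}" by simp
    qed
  qed
  then show ?thesis by blast
qed

section \<open>Proper representations and characteristic two\<close>

lemma gap_map_update:
  fixes d :: "nat \<Rightarrow> 'a::ring_1"
  assumes "0 < r"
  shows "gap_map r a d (n(0 := k)) = gap_map r a d (n(0 := 0)) + of_nat k * d 0"
proof -
  have "{..<r} = insert 0 {1..<r}" using assms by auto
  then show ?thesis by (simp add: gap_map_def nmult_eq)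
qed

text \<open>Changing the parameter at 0 moves the point by a multiple of \<open>d 0\<close> and so
  never leaves or enters \<open>C\<close>. The fibre is therefore a product of
  \<open>{..<L 0}\<close> with its slice at \<open>n 0 = 0\<close>.\<close>

lemma card_gap_box_fibre:
  fixes d :: "nat \<Rightarrow> 'a::ring_1"
  assumes "0 < r" and "0 < L 0" and C: "\<And>x k. x + of_nat k * d 0 \<in> C \<longleftrightarrow> x \<in> C"
  shows "L 0 dvd card {n \<in> gap_box r L. gap_map r a d n \<in> C}"
proof -
  let ?A = "{n \<in> gap_box r L. gap_map r a d n \<in> C}"
  let ?B = "{n \<in> ?A. n 0 = 0}"
  have inv: "gap_map r a d (n(0 := k)) \<in> C \<longleftrightarrow> gap_map r a d n \<in> C" for n k
    using gap_map_update[OF assms(1), of a d n k] gap_map_update[OF assms(1), of a d n "n 0"]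
    by (simp add: C)
  have box: "n(0 := k) \<in> gap_box r L" if "n \<in> gap_box r L" "k < L 0" for n k
    using that assms(1) by (auto simp: gap_box_def PiE_iff extensional_def)
  have "bij_betw (\<lambda>(k, n). n(0 := k)) ({..<L 0} \<times> ?B) ?A"
  proof (rule bij_betw_byWitness[where f' = "\<lambda>n. (n 0, n(0 := 0))"])
    show "(\<lambda>(k, n). n(0 := k)) ` ({..<L 0} \<times> ?B) \<subseteq> ?A"
      using box inv by auto
    show "(\<lambda>n. (n 0, n(0 := 0))) ` ?A \<subseteq> {..<L 0} \<times> ?B"
      using box inv assms(1,2) by (auto simp: gap_box_def)
  qed auto
  then have "card ({..<L 0} \<times> ?B) = card ?A" by (rule bij_betw_same_card)
  then have "card ?A = L 0 * card ?B" by (simp only: card_cartesian_product card_lessThan)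
  then show ?thesis by simp
qed

lemma proper_gap_card_section:
  fixes d :: "nat \<Rightarrow> 'a::ring_1"
  assumes "proper_gap_rep r a L d P" and "0 < r"
    and "\<And>x k. x + of_nat k * d 0 \<in> C \<longleftrightarrow> x \<in> C"
  shows "L 0 dvd card (P \<inter> C)"
proof -
  let ?A = "{n \<in> gap_box r L. gap_map r a d n \<in> C}"
  have P: "P = gap_map r a d ` gap_box r L" and inj: "inj_on (gap_map r a d) (gap_box r L)"
    and "2 \<le> L 0"
    using assms(1,2) by (auto simp: proper_gap_rep_def gap_rep_def)
  have "inj_on (gap_map r a d) ?A" using inj by (rule inj_on_subset) auto
  moreover have "P \<inter> C = gap_map r a d ` ?A" unfolding P by auto
  ultimately have "card (P \<inter> C) = card ?A" by (simp add: card_image)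
  then show ?thesis using card_gap_box_fibre[where d = d and C = C and L = L and a = a, OF assms(2) _ assms(3)]
      \<open>2 \<le> L 0\<close> by simp
qed

lemma gap_rep_0_singleton: "gap_rep 0 a L d P \<longleftrightarrow> P = {a}"
  by (simp add: gap_rep_def gap_map_def gap_box_def)

lemma not_proper_gap_nonzero:
  assumes "prime p" and "2 \<le> f"
    and card: "CARD('a::{field,finite}) = p ^ f" and char: "of_nat p = (0 :: 'a)"
  shows "\<not> is_proper_gap (UNIV - {0 :: 'a})"
proof
  assume "is_proper_gap (UNIV - {0 :: 'a})"
  then obtain r a L and d :: "nat \<Rightarrow> 'a" where rep: "proper_gap_rep r a L d (UNIV - {0})"
    by (auto simp: is_proper_gap_def)
  have p2: "2 \<le> p" using assms(1) prime_ge_2_nat by blast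
  have "p ^ 1 < p ^ f" using p2 assms(2) by (intro power_strict_increasing) auto
  then have lt: "p < CARD('a)" using card by simp
  have r: "0 < r"
  proof (rule ccontr)
    assume "\<not> 0 < r"
    with rep have "UNIV - {0 :: 'a} = {a}" by (simp add: proper_gap_rep_def gap_rep_0_singleton)
    then have "card (UNIV - {0 :: 'a}) = 1" by simp
    with lt p2 show False by (simp add: card_Diff_subset)
  qed
  with rep have L: "2 \<le> L 0" and d: "d 0 \<noteq> 0"
    by (auto simp: proper_gap_rep_def gap_rep_def)
  \<comment> \<open>Cosets of the line through \<open>d 0\<close>. Integer multiples make invariance
    immediate; \<open>H_eq\<close> reduces them modulo \<open>p\<close> for counting.\<close>
  define H where "H = (\<lambda>x. {x + of_int z * d 0 | z. True})"
  have H_eq: "H x = (\<lambda>k. x + of_nat k * d 0) ` {..<p}" for x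
  proof
    show "H x \<subseteq> (\<lambda>k. x + of_nat k * d 0) ` {..<p}"
    proof
      fix y assume "y \<in> H x"
      then obtain z where "y = x + of_int z * d 0" by (auto simp: H_def)
      then have "y = x + of_nat (nat (z mod int p)) * d 0"
        using of_nat_nat_mod[OF _ char, of z] p2 by simp
      moreover have "nat (z mod int p) < p" using p2 by (simp add: nat_less_iff)
      ultimately show "y \<in> (\<lambda>k. x + of_nat k * d 0) ` {..<p}" by blast
    qed
    show "(\<lambda>k. x + of_nat k * d 0) ` {..<p} \<subseteq> H x"
    proof
      fix y assume "y \<in> (\<lambda>k. x + of_nat k * d 0) ` {..<p}"
      then obtain k where "y = x + of_int (int k) * d 0" by auto
      then show "y \<in> H x" unfolding H_def by blast
    qed
  qed
  have card_H: "card (H x) = p" for x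
  proof -
    have "inj_on (\<lambda>k. x + of_nat k * d 0) {..<p}"
      using inj_on_of_nat_lessThan_char[OF assms(1) char] d by (auto simp: inj_on_def)
    then show ?thesis unfolding H_eq by (simp add: card_image)
  qed
  have inv: "y + of_nat k * d 0 \<in> H x \<longleftrightarrow> y \<in> H x" for x y k
  proof
    assume "y + of_nat k * d 0 \<in> H x"
    then obtain z where "y + of_nat k * d 0 = x + of_int z * d 0" by (auto simp: H_def)
    then have "y = x + of_int (z - int k) * d 0" by (simp add: algebra_simps)
    then show "y \<in> H x" unfolding H_def by blast
  next
    assume "y \<in> H x"
    then obtain z where "y = x + of_int z * d 0" by (auto simp: H_def)
    then have "y + of_nat k * d 0 = x + of_int (z + int k) * d 0" by (simp add: algebra_simps)
    then show "y + of_nat k * d 0 \<in> H x" unfolding H_def by blast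
  qed
  have L_dvd: "L 0 dvd card ((UNIV - {0}) \<inter> H x)" for x
    using rep r inv by (rule proper_gap_card_section)
  have "0 = 0 + of_int 0 * d 0" by simp
  then have "0 \<in> H 0" unfolding H_def by blast
  then have "card (H 0 - {0}) = p - 1" using card_H[of 0] by (simp add: card_Diff_singleton)
  moreover have "(UNIV - {0}) \<inter> H 0 = H 0 - {0}" by blast
  ultimately have "card ((UNIV - {0}) \<inter> H 0) = p - 1" by simp
  with L_dvd[of 0] have "L 0 dvd p - 1" by simp
  moreover have "L 0 dvd p"
  proof -
    \<comment> \<open>Here \<open>f > 1\<close> enters: a coset avoiding 0 exists, and its section
      has all \<open>p\<close> elements.\<close>
    have "H 0 \<noteq> UNIV" using card_H[of 0] lt by auto
    then obtain x where x: "x \<notin> H 0" by blast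
    have "0 \<notin> H x"
    proof
      assume "0 \<in> H x"
      then obtain z where "0 = x + of_int z * d 0" by (auto simp: H_def)
      then have "x = 0 + of_int (- z) * d 0" by (simp add: eq_neg_iff_add_eq_0)
      with x show False unfolding H_def by blast
    qed
    then have "(UNIV - {0}) \<inter> H x = H x" by auto
    with L_dvd[of x] card_H show ?thesis by simp
  qed
  ultimately have "L 0 dvd p - (p - 1)" by (rule dvd_diff_nat[rotated])
  also have "p - (p - 1) = 1" using p2 by simp
  finally show False using L by simp
qed

text \<open>Only the parity of \<open>n 0\<close> affects the point, and \<open>L 0\<close> is at
  least 2, so the opposite parity is available as 0 or 1.\<close>

lemma gap_char_2_closed:
  fixes d :: "nat \<Rightarrow> 'a::ring_1"
  assumes "gap_rep r a L d P" and "0 < r" and "(2 :: 'a) = 0" and "x \<in> P"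
  shows "x + d 0 \<in> P"
proof -
  have P: "P = gap_map r a d ` gap_box r L" and L: "2 \<le> L 0"
    using assms(1,2) by (auto simp: gap_rep_def)
  obtain n where n: "n \<in> gap_box r L" "x = gap_map r a d n" using assms(4) P by blast
  define k where "k = (if even (n 0) then 1 else 0 :: nat)"
  have "of_nat (n 0) + 1 = (of_nat k :: 'a)"
    using assms(3) by (cases "even (n 0)") (auto simp: k_def elim!: evenE oddE)
  then have "x + d 0 = gap_map r a d (n(0 := k))"
    using gap_map_update[OF assms(2), of a d n k] gap_map_update[OF assms(2), of a d n "n 0"]
    by (simp add: n(2) add.assoc distrib_right[symmetric])
       (metis distrib_right mult_1)
  moreover have "n(0 := k) \<in> gap_box r L"
    using n(1) assms(2) L by (auto simp: gap_box_def PiE_iff extensional_def k_def)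
  ultimately show ?thesis using P by blast
qed

section \<open>The prime field and the assembly of the cases\<close>

lemma nonzero_arith_prog:
  assumes "prime p" and "CARD('a::{field,finite}) = p" and "of_nat p = (0 :: 'a)"
  shows "UNIV - {0 :: 'a} = (\<lambda>n. 1 + of_nat n) ` {..<p - 1}"
proof (rule sym, rule card_subset_eq)
  note inj = inj_on_of_nat_lessThan_char[OF assms(1,3)]
  show "(\<lambda>n. 1 + of_nat n) ` {..<p - 1} \<subseteq> UNIV - {0 :: 'a}"
  proof (rule image_subsetI)
    fix n assume "n \<in> {..<p - 1}"
    then have "of_nat (Suc n) \<noteq> (of_nat 0 :: 'a)" using inj_onD[OF inj, of "Suc n" 0] by (auto simp: less_diff_conv)
    then show "1 + of_nat n \<in> UNIV - {0 :: 'a}" by simp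
  qed
  have "inj_on (\<lambda>n. 1 + of_nat n :: 'a) {..<p - 1}"
    using inj by (auto simp: inj_on_def)
  then show "card ((\<lambda>n. 1 + of_nat n :: 'a) ` {..<p - 1}) = card (UNIV - {0 :: 'a})"
    by (simp add: card_image card_Diff_subset assms(2))
qed simp

theorem theorem1p3:
  fixes p f q :: nat and U :: "'a::{field,finite} set"
  assumes "prime p" and "f \<ge> 1" and "q = p ^ f"
    and "CARD('a) = q"
    and "U = UNIV - {0}"
  shows "(odd p \<longrightarrow>
           is_gap U \<and>
           (f = 1 \<longrightarrow> is_arith_prog U) \<and>
           (f > 1 \<longrightarrow> \<not> is_proper_gap U \<and>
                       (\<exists>r a L d. r \<le> 2 * f \<and> improper_gap_rep r a L d U))) \<and>
         (p = 2 \<longrightarrow> (is_gap U \<longleftrightarrow> q = 2))"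
proof -
  \<comment> \<open>\<open>q = p ^ f\<close> vanishes in the field, hence so does
    \<open>p\<close>.\<close>
  have char: "of_nat p = (0 :: 'a)"
    using of_nat_card_eq_0[where 'a = 'a] assms(3,4) by simp
  have p2: "2 \<le> p" using assms(1) prime_ge_2_nat by blast
  have q2: "2 \<le> q" using p2 assms(2,3) self_le_power[of p f] by simp
  have card_U: "card U = q - 1" using assms(4,5) by (simp add: card_Diff_subset)
  have prime_field: "is_arith_prog U" "is_gap U" if "odd p" "f = 1"
  proof -
    \<comment> \<open>The rank-one representation has length \<open>p - 1\<close>, which must be at
      least 2.\<close>
    have p3: "3 \<le> p" using p2 that(1) by (cases "p = 2") auto
    have U: "U = (\<lambda>n. 1 + of_nat n) ` {..<p - 1}"
      using nonzero_arith_prog[OF assms(1) _ char] assms(3,4,5) that(2) by simp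
    then have "U = {1 + nmult n 1 | n. n < p - 1}" by (auto simp: nmult_eq)
    then show "is_arith_prog U" unfolding is_arith_prog_def using p3
      by (intro exI[of _ 1] exI[of _ "p - 1"]) simp
    have "gap_rep 1 1 (\<lambda>_. p - 1) (\<lambda>_. 1) U"
      unfolding gap_rep_def
    proof (intro conjI)
      show "U = gap_map 1 1 (\<lambda>_. 1) ` gap_box 1 (\<lambda>_. p - 1)"
      proof
        show "gap_map 1 1 (\<lambda>_. 1) ` gap_box 1 (\<lambda>_. p - 1) \<subseteq> U"
          by (auto simp: U gap_map_def gap_box_def nmult_eq)
        show "U \<subseteq> gap_map 1 1 (\<lambda>_. 1) ` gap_box 1 (\<lambda>_. p - 1)"
        proof
          fix x assume "x \<in> U"
          then obtain k where "k < p - 1" "x = 1 + of_nat k" using U by auto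
          then show "x \<in> gap_map 1 1 (\<lambda>_. 1) ` gap_box 1 (\<lambda>_. p - 1)"
            by (intro image_eqI[of _ _ "restrict (\<lambda>_. k) {..<1}"])
               (auto simp: gap_map_def gap_box_def nmult_eq)
        qed
      qed
    qed (use p3 in auto)
    then show "is_gap U" unfolding is_gap_def by blast
  qed
  have proper: "\<not> is_proper_gap U" if "f > 1"
    using not_proper_gap_nonzero[OF assms(1) _ _ char, of f] that assms(3,4,5) by simp
  have rep: "\<exists>a L d. gap_rep (2 * f) a L d U" if "odd p" "f > 1"
    using ex_gap_rep_nonzero[OF assms(1) that(1) _ _ char, of f] that(2) assms(3,4,5) by simp
  then have gap: "is_gap U" if "odd p"
    using prime_field(2) that assms(2) unfolding is_gap_def by (cases "f = 1") (simp, force)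
  \<comment> \<open>The representation of rank \<open>2 * f\<close> cannot be injective, since no
    proper one exists.\<close>
  have improper: "\<exists>r a L d. r \<le> 2 * f \<and> improper_gap_rep r a L d U" if "odd p" "f > 1"
    using rep[OF that] proper[OF that(2)]
    unfolding is_proper_gap_def proper_gap_rep_def improper_gap_rep_def by blast
  have two: "is_gap U \<longleftrightarrow> q = 2" if "p = 2"
  proof
    assume "is_gap U"
    then obtain r a L d where gr: "gap_rep r a L d U" by (auto simp: is_gap_def)
    have "r = 0"
    proof (rule ccontr)
      assume "r \<noteq> 0"
      then have "d 0 \<noteq> 0" using gr by (simp add: gap_rep_def)
      moreover have "2 = (0 :: 'a)" using char that by simp
      ultimately have "d 0 + d 0 \<in> U"
        using gap_char_2_closed[OF gr, of "d 0"] \<open>r \<noteq> 0\<close> assms(5) by simp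
      with \<open>2 = (0 :: 'a)\<close> assms(5) show False by (simp flip: mult_2)
    qed
    with gr have "U = {a}" by (simp add: gap_rep_0_singleton)
    with card_U q2 show "q = 2" by simp
  next
    assume "q = 2"
    with card_U obtain a where "U = {a}" by (auto simp: card_1_singleton_iff)
    then show "is_gap U" unfolding is_gap_def using gap_rep_0_singleton by blast
  qed
  show ?thesis using gap prime_field(1) proper improper two by blast
qed

end
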